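(* $${}^1\Big(\bigsqcup_{n \in \omega} \mathsf{TJ}^{(n)}\Big) \equiv_{\mathrm{sW}} \bigsqcup_{n \in \omega} \mathsf{C}_{\mathbb{N}}^{(n)}.$$
   Context: A problem is a partial multifunction $\mathsf{P} :\subseteq \omega^\omega \rightrightarrows \omega^\omega$. Each $f \in \mathrm{dom}(\mathsf{P})$ (so $\mathsf{P}(f) \neq \emptyset$) is a $\mathsf{P}$-instance, and each $g \in \mathsf{P}(f)$ is a $\mathsf{P}$-solution to $f$. Sets are identified with their characteristic functions. The set $\omega$ is embedded in $\omega^\omega$ by identifying $x \in \omega$ with the $f \in \omega^\omega$ such that $f(0)=x$ and $f(y)=0$ for all $y>0$; pairs of numbers are coded as single numbers. Angle brackets denote Turing joins. Turing functionals are regarded as partial maps $\omega^\omega \to \omega^\omega$, $\Psi(f,g)$ means $\Psi(\langle f,g\rangle)$, and $\Psi(f)(x)$ is the value at $x$ of the computation with oracle $f$. When a Turing functional is part of an instance, it is given by an index in a fixed computable listing of all Turing functionals. $\mathsf{Q} \leq_{\mathrm{sW}} \mathsf{P}$ (strongly Weihrauch reducible) if there are Turing functionals $\Phi,\Psi$ such that for all $f \in \mathrm{dom}(\mathsf{Q})$ we have $\Phi(f) \in \mathrm{dom}(\mathsf{P})$, and for every $g \in \mathsf{P}(\Phi(f))$ we have $\Psi(g) \in \mathsf{Q}(f)$. $\equiv_{\mathrm{sW}}$ is the induced equivalence relation. The first-order part ${}^1\mathsf{P}$ of a problem $\mathsf{P}$ is the following problem. Its instances are all triples $\langle f,\Phi,\Psi\rangle$,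 where $f \in \omega^\omega$ and $\Phi,\Psi$ are Turing functionals such that $\Phi(f) \in \mathrm{dom}(\mathsf{P})$ and $\Psi(f,g)(0)\downarrow$ for all $g \in \mathsf{P}(\Phi(f))$. The solutions to such an instance are all $y \in \omega$ such that $\Psi(f,g)(0)\downarrow = y$ for some $g \in \mathsf{P}(\Phi(f))$. The join $\bigsqcup_{n\in\omega} \mathsf{P}_n$ of a sequence of problems is the problem whose instances are all $\langle n,f\rangle$ with $n \in \omega$ and $f \in \mathrm{dom}(\mathsf{P}_n)$, with the solutions to $\langle n,f\rangle$ being all $\langle n,g\rangle$ with $g \in \mathsf{P}_n(f)$. The jump $\mathsf{P}'$ of a problem $\mathsf{P}$ has as instances all pairs $\langle f,i\rangle$ such that $f \in \omega^\omega$ and $i$ is a $\Delta^{0,f}_2$ index for a $\mathsf{P}$-instance $g$; the solutions to $\langle f,i\rangle$ are all the $\mathsf{P}$-solutions to $g$. $\mathsf{P}^{(0)}=\mathsf{P}$ and $\mathsf{P}^{(n+1)}=(\mathsf{P}^{(n)})'$. $\mathsf{TJ}$ (the Turing jump problem): instances are all $g \in \omega^\omega$; the unique solution to $g$ is its Turing jump $g'$. ($\mathsf{TJ}^{(n)}$ denotes the $n$-th jump of $\mathsf{TJ}$ as a problem.) $\mathsf{C}_{\mathbb{N}}$ (choice on $\omega$): instances are all enumerations of proper subsets of $\omega$; solutions are all $i \in \omega$ that are not enumerated. Explicitly, an instance is a function $v$ on $\omega$ whose values are natural numbers or a special symbol meaning that nothing has been enumerated yet, with $\omega \nsubseteq \mathrm{ran}(v)$,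 such that the special symbol is never taken after a different value, and if $v(s)=v(t)$ for some $s<t$ then $v$ is constant on $[s,t]$; the solutions are the $i \in \omega$ with $i \notin \mathrm{ran}(v)$. *)

theory Defs
  imports Main "HOL-Library.Nat_Bijection"
begin

section \<open>Turing functionals\<close>

text \<open>
  Turing functionals are presented as relativized partial recursive functions: all arguments
  are single numbers, tuples being coded with \<^const>\<open>prod_encode\<close>. \<open>CQuery\<close> asks for a value of
  the function \<open>f\<close> the computation is relative to.
\<close>

datatype code =
    CZero | CSucc | CFst | CSnd | CQuery
  | CPair code code
  | CComp code code
  | CPrec code code
  | CMu code

text \<open>
  The result \<^const>\<open>None\<close> means divergence. \<open>CPrec c d\<close> sends the pair \<open>(a, n)\<close> to the \<open>n\<close>-th value
  of the recursion starting with \<open>c(a)\<close> and stepping from \<open>r\<close> at stage \<open>m\<close> to \<open>d(a, (m, r))\<close>.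
  \<open>CMu c\<close> sends \<open>x\<close> to the least \<open>n\<close> with \<open>c(x, n) = 0\<close>, and requires \<open>c(x, m)\<close> to converge for
  all \<open>m < n\<close>.
\<close>

primrec run :: "code \<Rightarrow> (nat \<Rightarrow> nat) \<Rightarrow> nat \<Rightarrow> nat option" where
  "run CZero f x = Some 0"
| "run CSucc f x = Some (Suc x)"
| "run CFst f x = Some (fst (prod_decode x))"
| "run CSnd f x = Some (snd (prod_decode x))"
| "run CQuery f x = Some (f x)"
| "run (CPair c d) f x =
     Option.bind (run c f x) (\<lambda>a. Option.bind (run d f x) (\<lambda>b. Some (prod_encode (a, b))))"
| "run (CComp c d) f x = Option.bind (run d f x) (run c f)"
| "run (CPrec c d) f x =
     rec_nat (run c f (fst (prod_decode x)))
       (\<lambda>m r. Option.bind r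
          (\<lambda>v. run d f (prod_encode (fst (prod_decode x), prod_encode (m, v)))))
       (snd (prod_decode x))"
| "run (CMu c) f x =
     (if \<exists>n. run c f (prod_encode (x, n)) = Some 0 \<and>
             (\<forall>m<n. run c f (prod_encode (x, m)) \<noteq> None)
      then Some (LEAST n. run c f (prod_encode (x, n)) = Some 0)
      else None)"

text \<open>The fixed computable listing of all codes; it is a bijection.\<close>

function code_of :: "nat \<Rightarrow> code" where
  "code_of n =
     (if n = 0 then CZero
      else if n = 1 then CSucc
      else if n = 2 then CFst
      else if n = 3 then CSnd
      else if n = 4 then CQuery
      else (let k = (n - 5) div 4; r = (n - 5) mod 4 in
        if r = 0 then CPair (code_of (fst (prod_decode k))) (code_of (snd (prod_decode k)))
        else if r = 1 then CComp (code_of (fst (prod_decode k))) (code_of (snd (prod_decode k)))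
        else if r = 2 then CPrec (code_of (fst (prod_decode k))) (code_of (snd (prod_decode k)))
        else CMu (code_of k)))"
  by pat_completeness auto

lemma fst_prod_decode_le: "fst (prod_decode k) \<le> k"
  by (metis le_prod_encode_1 prod.collapse prod_decode_inverse)

lemma snd_prod_decode_le: "snd (prod_decode k) \<le> k"
  by (metis le_prod_encode_2 prod.collapse prod_decode_inverse)

lemma code_of_smaller:
  assumes "(n::nat) \<noteq> 0"
  shows "(n - 5) div 4 < n" "fst (prod_decode ((n - 5) div 4)) < n"
    "snd (prod_decode ((n - 5) div 4)) < n"
proof -
  show *: "(n - 5) div 4 < n"
    using assms by linarith
  show "fst (prod_decode ((n - 5) div 4)) < n" "snd (prod_decode ((n - 5) div 4)) < n"
    using * fst_prod_decode_le snd_prod_decode_le le_less_trans by blast+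
qed

termination code_of
  by (relation "measure id") (simp_all add: code_of_smaller)

declare code_of.simps [simp del]

primrec index_of :: "code \<Rightarrow> nat" where
  "index_of CZero = 0"
| "index_of CSucc = 1"
| "index_of CFst = 2"
| "index_of CSnd = 3"
| "index_of CQuery = 4"
| "index_of (CPair c d) = 4 * prod_encode (index_of c, index_of d) + 5"
| "index_of (CComp c d) = 4 * prod_encode (index_of c, index_of d) + 6"
| "index_of (CPrec c d) = 4 * prod_encode (index_of c, index_of d) + 7"
| "index_of (CMu c) = 4 * index_of c + 8"

lemma code_of_base:
  "code_of 0 = CZero" "code_of 1 = CSucc" "code_of 2 = CFst" "code_of 3 = CSnd" "code_of 4 = CQuery"
  by (subst code_of.simps, simp)+

lemma code_of_step:
  "code_of (4 * k + 5) = CPair (code_of (fst (prod_decode k))) (code_of (snd (prod_decode k)))"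
  "code_of (4 * k + 6) = CComp (code_of (fst (prod_decode k))) (code_of (snd (prod_decode k)))"
  "code_of (4 * k + 7) = CPrec (code_of (fst (prod_decode k))) (code_of (snd (prod_decode k)))"
  "code_of (4 * k + 8) = CMu (code_of k)"
proof -
  have "(4 * k + r) div 4 = k" "(4 * k + r) mod 4 = r" if "r < 4" for r
    using that by simp_all
  from this[of 0] this[of 1] this[of 2] this[of 3]
  have eqs: "(4 * k + 5 - 5) div 4 = k" "(4 * k + 5 - 5) mod 4 = 0"
       "(4 * k + 6 - 5) div 4 = k" "(4 * k + 6 - 5) mod 4 = 1"
       "(4 * k + 7 - 5) div 4 = k" "(4 * k + 7 - 5) mod 4 = 2"
       "(4 * k + 8 - 5) div 4 = k" "(4 * k + 8 - 5) mod 4 = 3"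
    by (simp_all del: One_nat_def)
  have ne: "4 * k + j \<noteq> 0" "4 * k + j \<noteq> 1" "4 * k + j \<noteq> 2" "4 * k + j \<noteq> 3" "4 * k + j \<noteq> 4"
    if "j \<ge> 5" for j
    using that by auto
  show "code_of (4 * k + 5) = CPair (code_of (fst (prod_decode k))) (code_of (snd (prod_decode k)))"
    unfolding code_of.simps[of "4 * k + 5"] Let_def eqs using ne[of 5] by simp
  show "code_of (4 * k + 6) = CComp (code_of (fst (prod_decode k))) (code_of (snd (prod_decode k)))"
    unfolding code_of.simps[of "4 * k + 6"] Let_def eqs using ne[of 6] by simp
  show "code_of (4 * k + 7) = CPrec (code_of (fst (prod_decode k))) (code_of (snd (prod_decode k)))"
    unfolding code_of.simps[of "4 * k + 7"] Let_def eqs using ne[of 7] by simp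
  show "code_of (4 * k + 8) = CMu (code_of k)"
    unfolding code_of.simps[of "4 * k + 8"] Let_def eqs using ne[of 8] by simp
qed

lemma code_of_index_of: "code_of (index_of c) = c"
  by (induction c)
    (simp_all only: index_of.simps code_of_base code_of_step prod_encode_inverse fst_conv snd_conv)

lemma index_of_code_of: "index_of (code_of n) = n"
proof (induction n rule: less_induct)
  case (less n)
  show ?case
  proof (cases "n < 5")
    case True
    then consider "n = 0" | "n = 1" | "n = 2" | "n = 3" | "n = 4" by linarith
    then show ?thesis by cases (simp_all only: code_of_base index_of.simps)
  next
    case False
    define k where "k = (n - 5) div 4"
    have n: "n = 4 * k + 5 \<or> n = 4 * k + 6 \<or> n = 4 * k + 7 \<or> n = 4 * k + 8"
      using False unfolding k_def by presburger
    then have "k < n" by linarith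
    then have IH: "index_of (code_of (fst (prod_decode k))) = fst (prod_decode k)"
      "index_of (code_of (snd (prod_decode k))) = snd (prod_decode k)"
      "index_of (code_of k) = k"
      using less.IH fst_prod_decode_le[of k] snd_prod_decode_le[of k] by (meson le_less_trans)+
    from n show ?thesis
      by (elim disjE)
        (simp_all only: code_of_step index_of.simps IH prod.collapse prod_decode_inverse)
  qed
qed

definition turing_functional :: "nat \<Rightarrow> (nat \<Rightarrow> nat) \<Rightarrow> nat \<Rightarrow> nat option" where
  "turing_functional e = run (code_of e)"

text \<open>\<open>maps_to e f g\<close> says that the functional with index \<open>e\<close>, regarded as a partial map on
  functions, is defined at \<open>f\<close> with value \<open>g\<close>.\<close>

definition maps_to :: "nat \<Rightarrow> (nat \<Rightarrow> nat) \<Rightarrow> (nat \<Rightarrow> nat) \<Rightarrow> bool" where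
  "maps_to e f g \<longleftrightarrow> (\<forall>x. turing_functional e f x = Some (g x))"

definition turing_jump :: "(nat \<Rightarrow> nat) \<Rightarrow> nat \<Rightarrow> nat" where
  "turing_jump f e = (if turing_functional e f e \<noteq> None then 1 else 0)"

definition embed :: "nat \<Rightarrow> nat \<Rightarrow> nat" where
  "embed x = (\<lambda>y. if y = 0 then x else 0)"

definition turing_join :: "(nat \<Rightarrow> nat) \<Rightarrow> (nat \<Rightarrow> nat) \<Rightarrow> nat \<Rightarrow> nat" where
  "turing_join f g = (\<lambda>n. if even n then f (n div 2) else g (n div 2))"


section \<open>Problems\<close>

text \<open>A partial multifunction; \<open>f\<close> lies outside the domain exactly if its value set is empty.\<close>

type_synonym problem = "(nat \<Rightarrow> nat) \<Rightarrow> (nat \<Rightarrow> nat) set"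

definition instances :: "problem \<Rightarrow> (nat \<Rightarrow> nat) set" where
  "instances P = {f. P f \<noteq> {}}"

definition strong_weihrauch_le :: "problem \<Rightarrow> problem \<Rightarrow> bool"  (infix \<open>\<le>\<^sub>s\<^sub>W\<close> 50) where
  "Q \<le>\<^sub>s\<^sub>W P \<longleftrightarrow>
     (\<exists>d e. \<forall>f \<in> instances Q.
        \<exists>p. maps_to d f p \<and> p \<in> instances P \<and> (\<forall>g \<in> P p. \<exists>h. maps_to e g h \<and> h \<in> Q f))"

definition strong_weihrauch_eq :: "problem \<Rightarrow> problem \<Rightarrow> bool"  (infix \<open>\<equiv>\<^sub>s\<^sub>W\<close> 50) where
  "P \<equiv>\<^sub>s\<^sub>W Q \<longleftrightarrow> P \<le>\<^sub>s\<^sub>W Q \<and> Q \<le>\<^sub>s\<^sub>W P"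

definition fo_instance :: "problem \<Rightarrow> (nat \<Rightarrow> nat) \<Rightarrow> nat \<Rightarrow> nat \<Rightarrow> (nat \<Rightarrow> nat) \<Rightarrow> bool" where
  "fo_instance P f d e p \<longleftrightarrow>
     maps_to d f p \<and> p \<in> instances P \<and>
     (\<forall>g \<in> P p. turing_functional e (turing_join f g) 0 \<noteq> None)"

definition first_order_part :: "problem \<Rightarrow> problem" where
  "first_order_part P h =
     {embed y | y f d e p g.
        h = turing_join f (turing_join (embed d) (embed e)) \<and> fo_instance P f d e p \<and>
        g \<in> P p \<and> turing_functional e (turing_join f g) 0 = Some y}"

definition problem_join :: "(nat \<Rightarrow> problem) \<Rightarrow> problem" where
  "problem_join P h = {turing_join (embed n) g | n f g. h = turing_join (embed n) f \<and> g \<in> P n f}"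

text \<open>A \<open>\<Delta>\<^sup>0\<^sub>2\<close> index for \<open>g\<close> relative to \<open>f\<close> is an index of a functional that takes the Turing jump
  of \<open>f\<close> to \<open>g\<close>.\<close>

definition delta2_index :: "(nat \<Rightarrow> nat) \<Rightarrow> nat \<Rightarrow> (nat \<Rightarrow> nat) \<Rightarrow> bool" where
  "delta2_index f i g \<longleftrightarrow> maps_to i (turing_jump f) g"

definition problem_jump :: "problem \<Rightarrow> problem" where
  "problem_jump P h = {s. \<exists>f i g. h = turing_join f (embed i) \<and> delta2_index f i g \<and> s \<in> P g}"

definition iter_jump :: "nat \<Rightarrow> problem \<Rightarrow> problem" where
  "iter_jump n P = (problem_jump ^^ n) P"

definition TJ :: problem where
  "TJ g = {turing_jump g}"

text \<open>The special symbol of an enumeration is \<^const>\<open>None\<close>; in a function from numbers to numbers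
  it is coded by \<open>0\<close>, and a number \<open>i\<close> is coded by \<open>i + 1\<close>.\<close>

definition enum_of :: "(nat \<Rightarrow> nat) \<Rightarrow> nat \<Rightarrow> nat option" where
  "enum_of h s = (case h s of 0 \<Rightarrow> None | Suc i \<Rightarrow> Some i)"

definition CN_enumeration :: "(nat \<Rightarrow> nat option) \<Rightarrow> bool" where
  "CN_enumeration v \<longleftrightarrow>
     \<not> range Some \<subseteq> range v \<and>
     (\<forall>s t. s < t \<longrightarrow> v s \<noteq> None \<longrightarrow> v t \<noteq> None) \<and>
     (\<forall>s t. s < t \<longrightarrow> v s = v t \<longrightarrow> (\<forall>u \<in> {s..t}. v u = v s))"

definition CN :: problem where
  "CN h = {embed i | i. CN_enumeration (enum_of h) \<and> Some i \<notin> range (enum_of h)}"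


subsection \<open>The instances of the problems above\<close>

lemma embed_eq_iff [simp]: "embed x = embed y \<longleftrightarrow> x = y"
  by (metis embed_def)

lemma turing_join_eq_iff [simp]: "turing_join f g = turing_join f' g' \<longleftrightarrow> f = f' \<and> g = g'"
proof
  assume eq: "turing_join f g = turing_join f' g'"
  have "f n = f' n" "g n = g' n" for n
    using fun_cong[OF eq, of "2 * n"] fun_cong[OF eq, of "2 * n + 1"]
    by (simp_all add: turing_join_def)
  then show "f = f' \<and> g = g'" by blast
qed simp

lemma instances_first_order_part:
  "instances (first_order_part P) =
     {turing_join f (turing_join (embed d) (embed e)) | f d e. \<exists>p. fo_instance P f d e p}"
proof (rule set_eqI)
  fix h
  have "first_order_part P h \<noteq> {}"
    if h: "h = turing_join f (turing_join (embed d) (embed e))" and p: "fo_instance P f d e p"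
    for f d e p
  proof -
    obtain g where g: "g \<in> P p"
      using p by (auto simp: fo_instance_def instances_def)
    then obtain y where "turing_functional e (turing_join f g) 0 = Some y"
      using p by (auto simp: fo_instance_def)
    then have "embed y \<in> first_order_part P h"
      unfolding first_order_part_def using h p g by blast
    then show ?thesis by blast
  qed
  then show "h \<in> instances (first_order_part P) \<longleftrightarrow>
    h \<in> {turing_join f (turing_join (embed d) (embed e)) | f d e. \<exists>p. fo_instance P f d e p}"
    unfolding instances_def by (auto simp: first_order_part_def)
qed

lemma instances_problem_join:
  "instances (problem_join P) = {turing_join (embed n) f | n f. f \<in> instances (P n)}"
  unfolding instances_def problem_join_def by blast

lemma instances_problem_jump:
  "instances (problem_jump P) =
     {turing_join f (embed i) | f i. \<exists>g \<in> instances P. delta2_index f i g}"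
  unfolding instances_def problem_jump_def by blast

lemma instances_TJ: "instances TJ = UNIV"
  by (simp add: instances_def TJ_def)

lemma instances_CN: "instances CN = {h. CN_enumeration (enum_of h)}"
proof -
  have "\<exists>i. Some i \<notin> range v" if "CN_enumeration v" for v
    using that unfolding CN_enumeration_def by blast
  then show ?thesis
    unfolding instances_def CN_def by fast
qed

end

(*
  An instance of the n-th jump of any problem P is resolved, through a chain of n Turing jumps that
  does not depend on P, to an instance v of P.

  From right to left: the Turing jump of an instance v of C_N decides which numbers are enumerated,
  so it computes the least omitted one. Hence an instance can be passed on unchanged.

  From left to right: let f, d, e be given and let Phi_d(f) be an instance of the n-th jump of TJ that
  resolves to v. The number n is found with the universal functional, while v' and hence the answer y
  are computable after n + 1 jumps. So ask the (n + 1)-st jump of C_N about the enumeration of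
  everything but y. Its chain carries f, n, e along with the original chain: since the jump of
  (f_k, i_k) computes f_k' and i_k, it computes the next pair of the original chain.
*)

theory Submission
  imports Defs
begin

section \<open>Uniform relative computability\<close>

text \<open>One code has to serve all parameters in A, and it sees nothing of a but the oracle
  \<open>R a\<close>. Restricting to A expresses promises such as convergence of a given
  functional.\<close>

definition computable_from :: "('a \<Rightarrow> nat \<Rightarrow> nat) \<Rightarrow> 'a set \<Rightarrow> ('a \<Rightarrow> nat \<Rightarrow> nat) \<Rightarrow> bool" where
  "computable_from R A F \<longleftrightarrow> (\<exists>c. \<forall>a\<in>A. \<forall>x. run c (R a) x = Some (F a x))"

text \<open>Truth is coded by \<open>0\<close>, the value that \<^const>\<open>CMu\<close> searches for.\<close>

definition decidable_from :: "('a \<Rightarrow> nat \<Rightarrow> nat) \<Rightarrow> 'a set \<Rightarrow> ('a \<Rightarrow> nat \<Rightarrow> bool) \<Rightarrow> bool" where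
  "decidable_from R A P \<longleftrightarrow> computable_from R A (\<lambda>a x. if P a x then 0 else 1)"

abbreviation "pfst z \<equiv> fst (prod_decode z)"
abbreviation "psnd z \<equiv> snd (prod_decode z)"

lemma computable_fromI: "(\<And>a x. a \<in> A \<Longrightarrow> run c (R a) x = Some (F a x)) \<Longrightarrow> computable_from R A F"
  unfolding computable_from_def by blast

lemma computable_fromE:
  assumes "computable_from R A F"
  obtains c where "\<And>a x. a \<in> A \<Longrightarrow> run c (R a) x = Some (F a x)"
  using assms unfolding computable_from_def by blast

lemma computable_from_cong:
  assumes "computable_from R A F" "\<And>a x. a \<in> A \<Longrightarrow> F a x = G a x"
  shows "computable_from R A G"
  using assms unfolding computable_from_def by metis

lemma maps_to_computable_from:
  assumes "computable_from R A F"
  obtains e where "\<And>a. a \<in> A \<Longrightarrow> maps_to e (R a) (F a)"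
proof -
  obtain c where c: "\<And>a x. a \<in> A \<Longrightarrow> run c (R a) x = Some (F a x)"
    using assms by (rule computable_fromE) blast
  show ?thesis
    by (rule that[of "index_of c"]) (simp add: maps_to_def turing_functional_def code_of_index_of c)
qed

section \<open>Closure under the basic operations\<close>

lemma computable_id: "computable_from R A (\<lambda>a x. x)"
  \<comment> \<open>There is no basic code for the identity. The inner pair restores x from its
    components, and \<open>CFst\<close> undoes the outer pairing with 0.\<close>
  by (rule computable_fromI[of _ "CComp CFst (CPair (CPair CFst CSnd) CZero)"]) simp

lemma computable_oracle: "computable_from R A R"
  by (rule computable_fromI[of _ CQuery]) simp

lemma computable_const: "computable_from R A (\<lambda>a x. k)"
proof (induction k)
  case 0
  show ?case by (rule computable_fromI[of _ CZero]) simp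
next
  case (Suc k)
  then obtain c where "\<And>a x. a \<in> A \<Longrightarrow> run c (R a) x = Some k"
    by (elim computable_fromE) blast
  then show ?case by (intro computable_fromI[of _ "CComp CSucc c"]) simp
qed

lemma computable_compose:
  assumes "computable_from R A F" "computable_from R A N"
  shows "computable_from R A (\<lambda>a x. F a (N a x))"
proof -
  obtain c d where "\<And>a x. a \<in> A \<Longrightarrow> run c (R a) x = Some (F a x)"
    and "\<And>a x. a \<in> A \<Longrightarrow> run d (R a) x = Some (N a x)"
    using assms by (elim computable_fromE) blast
  then show ?thesis by (intro computable_fromI[of _ "CComp c d"]) simp
qed

lemma computable_query: "computable_from R A N \<Longrightarrow> computable_from R A (\<lambda>a x. R a (N a x))"
  by (rule computable_compose[OF computable_oracle])

lemma computable_Suc: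
  assumes "computable_from R A N" shows "computable_from R A (\<lambda>a x. Suc (N a x))"
  by (rule computable_compose[OF _ assms], rule computable_fromI[of _ CSucc]) simp

lemma computable_pfst:
  assumes "computable_from R A N" shows "computable_from R A (\<lambda>a x. pfst (N a x))"
  by (rule computable_compose[OF _ assms], rule computable_fromI[of _ CFst]) simp

lemma computable_psnd:
  assumes "computable_from R A N" shows "computable_from R A (\<lambda>a x. psnd (N a x))"
  by (rule computable_compose[OF _ assms], rule computable_fromI[of _ CSnd]) simp

lemma computable_prod_encode:
  assumes "computable_from R A F" "computable_from R A G"
  shows "computable_from R A (\<lambda>a x. prod_encode (F a x, G a x))"
proof -
  obtain c d where "\<And>a x. a \<in> A \<Longrightarrow> run c (R a) x = Some (F a x)"
    and "\<And>a x. a \<in> A \<Longrightarrow> run d (R a) x = Some (G a x)"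
    using assms by (elim computable_fromE) blast
  then show ?thesis by (intro computable_fromI[of _ "CPair c d"]) simp
qed

lemma computable_rec_nat:
  assumes B: "computable_from R A B"
    and D: "computable_from R A (\<lambda>a z. D a (pfst z) (pfst (psnd z)) (psnd (psnd z)))"
    and N: "computable_from R A N"
  shows "computable_from R A (\<lambda>a x. rec_nat (B a x) (D a x) (N a x))"
proof -
  obtain b d where b: "\<And>a x. a \<in> A \<Longrightarrow> run b (R a) x = Some (B a x)"
    and d: "\<And>a z. a \<in> A \<Longrightarrow> run d (R a) z = Some (D a (pfst z) (pfst (psnd z)) (psnd (psnd z)))"
    using B D by (elim computable_fromE) blast
  have "computable_from R A (\<lambda>a z. rec_nat (B a (pfst z)) (D a (pfst z)) (psnd z))"
  proof (rule computable_fromI[of _ "CPrec b d"])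
    fix a z assume a: "a \<in> A"
    \<comment> \<open>All values needed converge on A, so the recursion on options agrees with the
      recursion on numbers.\<close>
    have "rec_nat (Some (B a u)) (\<lambda>m r. Option.bind r
            (\<lambda>v. run d (R a) (prod_encode (u, prod_encode (m, v))))) n =
          Some (rec_nat (B a u) (D a u) n)" for u n
      by (induction n) (simp_all add: d[OF a])
    then show "run (CPrec b d) (R a) z = Some (rec_nat (B a (pfst z)) (D a (pfst z)) (psnd z))"
      by (simp add: b[OF a])
  qed
  \<comment> \<open>In \<open>CPrec\<close> the argument x serves as the fixed parameter, next to
    the recursion length \<open>N a x\<close>.\<close>
  from computable_compose[OF this computable_prod_encode[OF computable_id N]]
  show ?thesis by simp
qed

section \<open>Decidable predicates, arithmetic and searches\<close>

lemma decidable_zero: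
  assumes "computable_from R A N" shows "decidable_from R A (\<lambda>a x. N a x = 0)"
proof -
  have "computable_from R A (\<lambda>a x. rec_nat 0 (\<lambda>_ _. 1) (N a x))"
    by (intro computable_rec_nat computable_const assms)
  moreover have "rec_nat 0 (\<lambda>_ _. 1) n = (if n = 0 then 0 else 1)" for n :: nat
    by (cases n) simp_all
  ultimately show ?thesis
    unfolding decidable_from_def by (elim computable_from_cong) blast
qed

lemma computable_if:
  assumes "decidable_from R A P" "computable_from R A F" "computable_from R A G"
  shows "computable_from R A (\<lambda>a x. if P a x then F a x else G a x)"
proof -
  \<comment> \<open>Recursion along the truth value: no step returns the first branch, one step
    replaces it by the second.\<close>
  have "computable_from R A (\<lambda>a x. rec_nat (F a x) (\<lambda>_ _. G a x) (if P a x then 0 else 1))"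
    by (intro computable_rec_nat assms(2) computable_compose[OF assms(3)] computable_pfst
        computable_id assms(1)[unfolded decidable_from_def])
  then show ?thesis by (rule computable_from_cong) simp
qed

lemma decidable_not:
  assumes "decidable_from R A P" shows "decidable_from R A (\<lambda>a x. \<not> P a x)"
  using computable_if[OF assms computable_const[of _ _ 1] computable_const[of _ _ 0]]
  unfolding decidable_from_def by (rule computable_from_cong) simp

lemma decidable_conj:
  assumes "decidable_from R A P" "decidable_from R A Q"
  shows "decidable_from R A (\<lambda>a x. P a x \<and> Q a x)"
  using computable_if[OF assms(1) assms(2)[unfolded decidable_from_def] computable_const[of _ _ 1]]
  unfolding decidable_from_def by (rule computable_from_cong) simp

lemma decidable_disj:
  assumes "decidable_from R A P" "decidable_from R A Q"
  shows "decidable_from R A (\<lambda>a x. P a x \<or> Q a x)"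
  using decidable_not[OF decidable_conj[OF assms[THEN decidable_not]]] by simp

lemma decidable_imp:
  assumes "decidable_from R A P" "decidable_from R A Q"
  shows "decidable_from R A (\<lambda>a x. P a x \<longrightarrow> Q a x)"
  using decidable_disj[OF decidable_not[OF assms(1)] assms(2)] by simp

lemma computable_add:
  assumes "computable_from R A F" "computable_from R A G"
  shows "computable_from R A (\<lambda>a x. F a x + G a x)"
proof -
  have "computable_from R A (\<lambda>a x. rec_nat (F a x) (\<lambda>_ r. Suc r) (G a x))"
    by (intro computable_rec_nat assms computable_Suc computable_psnd computable_id)
  moreover have "rec_nat m (\<lambda>_ r. Suc r) n = m + n" for m n
    by (induction n) simp_all
  ultimately show ?thesis by simp
qed

lemma computable_mult:
  assumes "computable_from R A F" "computable_from R A G"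
  shows "computable_from R A (\<lambda>a x. F a x * G a x)"
proof -
  have "computable_from R A (\<lambda>a x. rec_nat 0 (\<lambda>_ r. r + F a x) (G a x))"
    by (intro computable_rec_nat computable_add assms computable_const computable_psnd
        computable_compose[OF assms(1)] computable_pfst computable_id)
  moreover have "rec_nat 0 (\<lambda>_ r. r + m) n = m * n" for m n :: nat
    by (induction n) simp_all
  ultimately show ?thesis by simp
qed

lemma computable_diff:
  assumes "computable_from R A F" "computable_from R A G"
  shows "computable_from R A (\<lambda>a x. F a x - G a x)"
proof -
  \<comment> \<open>The predecessor is the stage number seen by the last recursion step, with value
    0 at 0.\<close>
  have "computable_from R A (\<lambda>a x. rec_nat 0 (\<lambda>m r. m) x)"
    by (intro computable_rec_nat computable_const computable_id computable_psnd computable_pfst)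
  moreover have "rec_nat 0 (\<lambda>m r. m) n = n - 1" for n :: nat
    by (cases n) simp_all
  ultimately have pred: "computable_from R A (\<lambda>a x. x - 1)" by simp
  have "computable_from R A (\<lambda>a x. rec_nat (F a x) (\<lambda>m r. r - 1) (G a x))"
    by (intro computable_rec_nat assms computable_compose[OF pred] computable_psnd computable_id)
  moreover have "rec_nat m (\<lambda>_ r. r - 1) n = m - n" for m n :: nat
    by (induction n) simp_all
  ultimately show ?thesis by simp
qed

lemma decidable_le:
  assumes "computable_from R A F" "computable_from R A G"
  shows "decidable_from R A (\<lambda>a x. F a x \<le> G a x)"
  using decidable_zero[OF computable_diff[OF assms]] by simp

lemma decidable_less:
  assumes "computable_from R A F" "computable_from R A G"
  shows "decidable_from R A (\<lambda>a x. F a x < G a x)"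
  using decidable_not[OF decidable_le[OF assms(2,1)]] by (simp add: not_le)

lemma decidable_eq:
  assumes "computable_from R A F" "computable_from R A G"
  shows "decidable_from R A (\<lambda>a x. F a x = G a x)"
  using decidable_conj[OF decidable_le[OF assms] decidable_le[OF assms(2,1)]]
  by (simp only: order_eq_iff[symmetric])

text \<open>A test that always returns 0 or 1 always converges, so the convergence condition in the
  semantics of \<open>CMu\<close> holds trivially.\<close>

lemma run_CMu_decision:
  assumes "\<And>n. run c f (prod_encode (x, n)) = Some (if P n then 0 else 1)"
  shows "run (CMu c) f x = (if \<exists>n. P n then Some (LEAST n. P n) else None)"
  by (simp add: assms)

lemma computable_Least:
  assumes P: "decidable_from R A (\<lambda>a z. P a (pfst z) (psnd z))"
    and ex: "\<And>a x. a \<in> A \<Longrightarrow> \<exists>n. P a x n"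
  shows "computable_from R A (\<lambda>a x. LEAST n. P a x n)"
proof -
  obtain c where c: "\<And>a z. a \<in> A \<Longrightarrow>
      run c (R a) z = Some (if P a (pfst z) (psnd z) then 0 else 1)"
    using P unfolding decidable_from_def by (elim computable_fromE) blast
  show ?thesis
  proof (rule computable_fromI[of _ "CMu c"])
    fix a x assume a: "a \<in> A"
    show "run (CMu c) (R a) x = Some (LEAST n. P a x n)"
      using ex[OF a, of x] by (subst run_CMu_decision[where P = "P a x"]) (simp_all add: c[OF a])
  qed
qed

lemma decidable_compose:
  assumes "decidable_from R A P" "computable_from R A N"
  shows "decidable_from R A (\<lambda>a x. P a (N a x))"
  using computable_compose[OF assms(1)[unfolded decidable_from_def] assms(2)]
  unfolding decidable_from_def .

lemma decidable_bex:
  assumes P: "decidable_from R A (\<lambda>a z. P a (pfst z) (psnd z))" and N: "computable_from R A N"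
  shows "decidable_from R A (\<lambda>a x. \<exists>n < N a x. P a x n)"
proof -
  \<comment> \<open>The extra alternative stops the search at the bound; stopping earlier means that
    a witness was found.\<close>
  have "computable_from R A (\<lambda>a x. LEAST n. n = N a x \<or> P a x n)"
    by (rule computable_Least)
      (auto intro!: decidable_disj P decidable_eq computable_psnd computable_id
        computable_compose[OF N] computable_pfst)
  then have "decidable_from R A (\<lambda>a x. (LEAST n. n = N a x \<or> P a x n) < N a x)"
    by (rule decidable_less) (rule N)
  moreover have "(LEAST n. n = k \<or> Q n) < k \<longleftrightarrow> (\<exists>n<k. Q n)" for Q and k :: nat
  proof
    assume less: "(LEAST n. n = k \<or> Q n) < k"
    have "(LEAST n. n = k \<or> Q n) = k \<or> Q (LEAST n. n = k \<or> Q n)"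
      by (rule LeastI[of _ k]) simp
    then show "\<exists>n<k. Q n" using less by auto
  next
    assume "\<exists>n<k. Q n"
    then obtain n where "n < k" "Q n" by blast
    then show "(LEAST n. n = k \<or> Q n) < k"
      using Least_le[of "\<lambda>n. n = k \<or> Q n" n] by simp
  qed
  ultimately show ?thesis by simp
qed

lemma decidable_ball:
  assumes P: "decidable_from R A (\<lambda>a z. P a (pfst z) (psnd z))" and N: "computable_from R A N"
  shows "decidable_from R A (\<lambda>a x. \<forall>n < N a x. P a x n)"
  using decidable_not[OF decidable_bex[where P = "\<lambda>a x n. \<not> P a x n", OF decidable_not[OF P] N]]
  by simp

lemma computable_div2:
  assumes "computable_from R A N" shows "computable_from R A (\<lambda>a x. N a x div 2)"
proof -
  have "\<exists>k. x < 2 * k + 2" for x :: nat by presburger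
  then have "computable_from R A (\<lambda>a x. LEAST k. x < 2 * k + 2)"
    by (intro computable_Least decidable_less computable_add computable_mult computable_const
        computable_psnd computable_pfst computable_id)
  moreover have "(LEAST k. x < 2 * k + 2) = x div 2" for x :: nat
    by (rule Least_equality) linarith+
  ultimately have "computable_from R A (\<lambda>a x. x div 2)" by simp
  then show ?thesis by (rule computable_compose) (rule assms)
qed

lemma decidable_even:
  assumes "computable_from R A N" shows "decidable_from R A (\<lambda>a x. even (N a x))"
proof -
  have "decidable_from R A (\<lambda>a x. N a x = 2 * (N a x div 2))"
    by (intro decidable_eq computable_mult computable_const computable_div2 assms)
  moreover have "n = 2 * (n div 2) \<longleftrightarrow> even n" for n :: nat by presburger
  ultimately show ?thesis by simp
qed

lemma decidable_set_decode:
  assumes "computable_from R A N" "computable_from R A D"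
  shows "decidable_from R A (\<lambda>a x. N a x \<in> set_decode (D a x))"
proof -
  \<comment> \<open>Membership in a coded finite set is a binary digit, which repeated halving moves
    to the last place.\<close>
  have "computable_from R A (\<lambda>a x. rec_nat (D a x) (\<lambda>_ r. r div 2) (N a x))"
    by (intro computable_rec_nat assms computable_div2 computable_psnd computable_id)
  moreover have "rec_nat m (\<lambda>_ r. r div 2) n = m div 2 ^ n" for m n :: nat
    by (induction n) (simp_all add: div_mult2_eq power_Suc2 del: power_Suc)
  ultimately have "decidable_from R A (\<lambda>a x. odd (D a x div 2 ^ N a x))"
    by (intro decidable_not decidable_even) simp
  then show ?thesis by (simp add: set_decode_def)
qed

lemma computable_turing_join:
  assumes "computable_from R A F" "computable_from R A G"
  shows "computable_from R A (\<lambda>a. turing_join (F a) (G a))"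
  unfolding turing_join_def
  by (intro computable_if decidable_even computable_id computable_div2
      computable_compose[OF assms(1)] computable_compose[OF assms(2)])

lemma computable_embed:
  assumes "computable_from R A (\<lambda>a x. N a)"
  shows "computable_from R A (\<lambda>a. embed (N a))"
  unfolding embed_def by (intro computable_if decidable_eq computable_id computable_const assms)

lemmas computability_rules =
  computable_const computable_id computable_oracle computable_query computable_Suc computable_pfst
  computable_psnd computable_prod_encode computable_add computable_mult computable_diff
  computable_if computable_div2 decidable_le decidable_less decidable_eq decidable_even
  decidable_set_decode decidable_bex decidable_ball decidable_not decidable_conj decidable_disj
  decidable_imp

section \<open>Composition of functionals\<close>

primrec subst_oracle :: "code \<Rightarrow> code \<Rightarrow> code" where
  "subst_oracle r CZero = CZero"
| "subst_oracle r CSucc = CSucc"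
| "subst_oracle r CFst = CFst"
| "subst_oracle r CSnd = CSnd"
| "subst_oracle r CQuery = r"
| "subst_oracle r (CPair c d) = CPair (subst_oracle r c) (subst_oracle r d)"
| "subst_oracle r (CComp c d) = CComp (subst_oracle r c) (subst_oracle r d)"
| "subst_oracle r (CPrec c d) = CPrec (subst_oracle r c) (subst_oracle r d)"
| "subst_oracle r (CMu c) = CMu (subst_oracle r c)"

text \<open>Since r answers every query, the two computations agree on divergence as well as on
  values. This is what allows the result to be used for Turing jumps.\<close>

lemma run_subst_oracle:
  assumes "\<And>x. run r f x = Some (g x)"
  shows "run (subst_oracle r c) f = run c g"
  by (induction c) (simp_all add: fun_eq_iff assms cong: Option.bind_cong)

lemma computable_from_trans:
  assumes "computable_from R A F" "computable_from F A G"
  shows "computable_from R A G"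
proof -
  obtain r c where "\<And>a x. a \<in> A \<Longrightarrow> run r (R a) x = Some (F a x)"
    and "\<And>a x. a \<in> A \<Longrightarrow> run c (F a) x = Some (G a x)"
    using assms by (elim computable_fromE) blast
  then show ?thesis
    by (intro computable_fromI[of _ "subst_oracle r c"]) (simp add: run_subst_oracle)
qed

section \<open>A universal functional\<close>

abbreviation triple :: "nat \<Rightarrow> nat \<Rightarrow> nat \<Rightarrow> nat" where
  "triple i x y \<equiv> prod_encode (i, prod_encode (x, y))"

text \<open>A trace is a finite set of triples \<open>(i, x, y)\<close>, read as "the functional with index \<open>i\<close> sends \<open>x\<close>
  to \<open>y\<close>". The numbers \<open>4 * k + r\<close> below are those of \<^const>\<open>index_of\<close>. As the clauses are positive
  in \<open>E\<close>, closed traces are closed under unions, and the universal functional can search for one.\<close>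

definition justified :: "(nat \<Rightarrow> nat) \<Rightarrow> nat set \<Rightarrow> nat \<Rightarrow> nat \<Rightarrow> nat \<Rightarrow> bool" where
  "justified f E i x y \<longleftrightarrow>
     i = 0 \<and> y = 0 \<or> i = 1 \<and> y = Suc x \<or> i = 2 \<and> y = pfst x \<or> i = 3 \<and> y = psnd x \<or>
     i = 4 \<and> y = f x \<or>
     (\<exists>k. i = 4 * k + 5 \<and> triple (pfst k) x (pfst y) \<in> E \<and> triple (psnd k) x (psnd y) \<in> E) \<or>
     (\<exists>k. i = 4 * k + 6 \<and> (\<exists>v. triple (psnd k) x v \<in> E \<and> triple (pfst k) v y \<in> E)) \<or>
     (\<exists>k. i = 4 * k + 7 \<and>
        (psnd x = 0 \<and> triple (pfst k) (pfst x) y \<in> E \<or>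
         (\<exists>m. psnd x = Suc m \<and> (\<exists>v. triple i (prod_encode (pfst x, m)) v \<in> E \<and>
            triple (psnd k) (prod_encode (pfst x, prod_encode (m, v))) y \<in> E)))) \<or>
     (\<exists>k. i = 4 * k + 8 \<and> triple k (prod_encode (x, y)) 0 \<in> E \<and>
        (\<forall>m<y. \<exists>v. v \<noteq> 0 \<and> triple k (prod_encode (x, m)) v \<in> E))"

definition closed_trace :: "(nat \<Rightarrow> nat) \<Rightarrow> nat set \<Rightarrow> bool" where
  "closed_trace f E \<longleftrightarrow> (\<forall>i x y. triple i x y \<in> E \<longrightarrow> justified f E i x y)"

lemma mod4_simps:
  "4 * a + 5 \<noteq> 4 * b + 6" "4 * a + 5 \<noteq> 4 * b + 7" "4 * a + 5 \<noteq> 4 * b + 8"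
  "4 * a + 6 \<noteq> 4 * b + 5" "4 * a + 6 \<noteq> 4 * b + 7" "4 * a + 6 \<noteq> 4 * b + 8"
  "4 * a + 7 \<noteq> 4 * b + 5" "4 * a + 7 \<noteq> 4 * b + 6" "4 * a + 7 \<noteq> 4 * b + 8"
  "4 * a + 8 \<noteq> 4 * b + 5" "4 * a + 8 \<noteq> 4 * b + 6" "4 * a + 8 \<noteq> 4 * b + 7"
  for a b :: nat
  by presburger+

lemma justified_simps:
  "justified f E 0 x y \<longleftrightarrow> y = 0"
  "justified f E 1 x y \<longleftrightarrow> y = Suc x"
  "justified f E 2 x y \<longleftrightarrow> y = pfst x"
  "justified f E 3 x y \<longleftrightarrow> y = psnd x"
  "justified f E 4 x y \<longleftrightarrow> y = f x"
  "justified f E (4 * k + 5) x y \<longleftrightarrow>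
     triple (pfst k) x (pfst y) \<in> E \<and> triple (psnd k) x (psnd y) \<in> E"
  "justified f E (4 * k + 6) x y \<longleftrightarrow>
     (\<exists>v. triple (psnd k) x v \<in> E \<and> triple (pfst k) v y \<in> E)"
  "justified f E (4 * k + 7) x y \<longleftrightarrow>
     psnd x = 0 \<and> triple (pfst k) (pfst x) y \<in> E \<or>
     (\<exists>m. psnd x = Suc m \<and> (\<exists>v. triple (4 * k + 7) (prod_encode (pfst x, m)) v \<in> E \<and>
            triple (psnd k) (prod_encode (pfst x, prod_encode (m, v))) y \<in> E))"
  "justified f E (4 * k + 8) x y \<longleftrightarrow>
     triple k (prod_encode (x, y)) 0 \<in> E \<and>
        (\<forall>m<y. \<exists>v. v \<noteq> 0 \<and> triple k (prod_encode (x, m)) v \<in> E)"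
  unfolding justified_def by (simp_all add: mod4_simps)

text \<open>Brings the semantics of \<open>CMu\<close> into the form of the last clause of
  \<open>justified\<close>, where every failed test is recorded with a nonzero value.\<close>

lemma run_CMu_eq_Some:
  "run (CMu c) f x = Some y \<longleftrightarrow> run c f (prod_encode (x, y)) = Some 0 \<and>
     (\<forall>m<y. \<exists>v. v \<noteq> 0 \<and> run c f (prod_encode (x, m)) = Some v)"
proof -
  define P where "P n \<longleftrightarrow> run c f (prod_encode (x, n)) = Some 0" for n
  define Q where "Q n \<longleftrightarrow> run c f (prod_encode (x, n)) \<noteq> None" for n
  have run: "run (CMu c) f x = (if \<exists>n. P n \<and> (\<forall>m<n. Q m) then Some (LEAST n. P n) else None)"
    unfolding P_def Q_def by simp
  have v: "(\<exists>v. v \<noteq> 0 \<and> run c f (prod_encode (x, m)) = Some v) \<longleftrightarrow> Q m \<and> \<not> P m" for m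
    unfolding P_def Q_def by auto
  have least: "(LEAST n. P n) = y" if "P y" "\<forall>m<y. \<not> P m"
    using that by (intro Least_equality) (auto simp: not_le[symmetric])
  \<comment> \<open>The least zero lies at or below any zero n, so it inherits convergence of all
    earlier tests from n.\<close>
  have "P (LEAST n. P n) \<and> (\<forall>m < (LEAST n. P n). Q m \<and> \<not> P m)" if "P n" "\<forall>m<n. Q m" for n
    using that LeastI[of P n] Least_le[of P n] not_less_Least[of _ P] by (meson less_le_trans)
  then show ?thesis
    unfolding run v P_def[symmetric] using least by (smt (verit) option.distinct(1) option.inject)
qed

text \<open>Every triple of a closed trace is backed by triples for smaller codes, or for the same
  recursion with fewer steps, so an induction on the code reaches the basic clauses.\<close>

lemma closed_trace_sound:
  assumes "closed_trace f E"
  shows "triple (index_of c) x y \<in> E \<Longrightarrow> run c f x = Some y"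
proof -
  have closed: "justified f E i x y" if "triple i x y \<in> E" for i x y
    using assms that unfolding closed_trace_def by blast
  show "triple (index_of c) x y \<in> E \<Longrightarrow> run c f x = Some y"
  proof (induction c arbitrary: x y)
    case (CPair c d)
    then have "justified f E (index_of (CPair c d)) x y"
      by (blast intro: closed)
    then have "run c f x = Some (pfst y)" "run d f x = Some (psnd y)"
      using CPair.IH by (auto simp: justified_simps)
    then show ?case by simp
  next
    case (CComp c d)
    then have "justified f E (index_of (CComp c d)) x y"
      by (blast intro: closed)
    then obtain v where "run d f x = Some v" "run c f v = Some y"
      using CComp.IH by (auto simp: justified_simps)
    then show ?case by simp
  next
    case (CPrec c d)
    \<comment> \<open>The recursion clause refers back to its own index, so the induction on codes
      needs an inner one on the recursion length.\<close>
    have "triple (index_of (CPrec c d)) (prod_encode (u, n)) y \<in> E \<Longrightarrow>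
        run (CPrec c d) f (prod_encode (u, n)) = Some y" for u n y
    proof (induction n arbitrary: y)
      case 0
      then have "justified f E (index_of (CPrec c d)) (prod_encode (u, 0)) y"
        by (blast intro: closed)
      then show ?case using CPrec.IH by (auto simp: justified_simps)
    next
      case (Suc n)
      then have "justified f E (index_of (CPrec c d)) (prod_encode (u, Suc n)) y"
        by (blast intro: closed)
      then obtain v where "triple (index_of (CPrec c d)) (prod_encode (u, n)) v \<in> E"
        and "triple (index_of d) (prod_encode (u, prod_encode (n, v))) y \<in> E"
        by (auto simp: justified_simps)
      then have "run (CPrec c d) f (prod_encode (u, n)) = Some v"
        and "run d f (prod_encode (u, prod_encode (n, v))) = Some y"
        using Suc.IH CPrec.IH by blast+
      then show ?case by simp
    qed
    from this[of "pfst x" "psnd x" y] CPrec.prems show ?case by simp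
  next
    case (CMu c)
    then have "justified f E (index_of (CMu c)) x y"
      by (blast intro: closed)
    then show ?case
      unfolding run_CMu_eq_Some using CMu.IH by (simp add: justified_simps) blast
  qed (auto simp: justified_simps dest!: closed simp flip: One_nat_def)
qed

lemma justified_mono: "justified f E i x y \<Longrightarrow> E \<subseteq> E' \<Longrightarrow> justified f E' i x y"
  unfolding justified_def
  by (elim disj_forward conj_forward ex_forward all_forward imp_forward) (simp_all add: subsetD)

section \<open>Every convergent computation has a finite trace\<close>

definition traceable :: "(nat \<Rightarrow> nat) \<Rightarrow> nat \<Rightarrow> bool" where
  "traceable f t \<longleftrightarrow> (\<exists>E. finite E \<and> closed_trace f E \<and> t \<in> E)"

lemma traceable_common_trace:
  assumes "finite J" "\<And>t. t \<in> J \<Longrightarrow> traceable f t"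
  obtains E where "finite E" "closed_trace f E" "J \<subseteq> E"
proof -
  have "\<forall>t\<in>J. \<exists>E. finite E \<and> closed_trace f E \<and> t \<in> E"
    using assms(2) unfolding traceable_def by blast
  then obtain T where T: "\<And>t. t \<in> J \<Longrightarrow> finite (T t) \<and> closed_trace f (T t) \<and> t \<in> T t"
    by metis
  show ?thesis
  proof (rule that[of "\<Union>t\<in>J. T t"])
    show "closed_trace f (\<Union>t\<in>J. T t)"
      using T unfolding closed_trace_def by (blast intro: justified_mono)
  qed (use T assms(1) in auto)
qed

text \<open>The premises J of one inference step have a common finite closed trace, and adding the
  conclusion keeps it closed by monotonicity.\<close>

lemma traceableI:
  assumes "finite J" "\<And>t. t \<in> J \<Longrightarrow> traceable f t" "justified f J i x y"
  shows "traceable f (triple i x y)"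
proof -
  obtain E where E: "finite E" "closed_trace f E" "J \<subseteq> E"
    using traceable_common_trace[OF assms(1,2)] by blast
  have "closed_trace f (insert (triple i x y) E)"
    unfolding closed_trace_def
  proof (intro allI impI)
    fix i' x' y' assume "triple i' x' y' \<in> insert (triple i x y) E"
    then have "justified f E i' x' y'"
      using E(2,3) assms(3) unfolding closed_trace_def by (auto intro: justified_mono)
    then show "justified f (insert (triple i x y) E) i' x' y'"
      by (rule justified_mono) blast
  qed
  then show ?thesis
    using E(1) unfolding traceable_def by (intro exI[of _ "insert (triple i x y) E"]) simp
qed

text \<open>A convergent computation rests on finitely many convergent subcomputations, and these
  are the premises J of one inference step.\<close>

lemma run_traceable: "run c f x = Some y \<Longrightarrow> traceable f (triple (index_of c) x y)"
proof (induction c arbitrary: x y)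
  case (CPair c d)
  then obtain a b where "run c f x = Some a" "run d f x = Some b" "y = prod_encode (a, b)"
    by (auto simp: bind_eq_Some_conv)
  then show ?case using CPair.IH
    by (intro traceableI[of "{triple (index_of c) x a, triple (index_of d) x b}"])
      (auto simp: justified_simps)
next
  case (CComp c d)
  then obtain v where "run d f x = Some v" "run c f v = Some y"
    by (auto simp: bind_eq_Some_conv)
  then show ?case using CComp.IH
    by (intro traceableI[of "{triple (index_of d) x v, triple (index_of c) v y}"])
      (auto simp: justified_simps)
next
  case (CPrec c d)
  have "run (CPrec c d) f (prod_encode (u, n)) = Some y \<Longrightarrow>
      traceable f (triple (index_of (CPrec c d)) (prod_encode (u, n)) y)" for u n y
  proof (induction n arbitrary: y)
    case 0
    then show ?case using CPrec.IH
      by (intro traceableI[of "{triple (index_of c) u y}"]) (auto simp: justified_simps)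
  next
    case (Suc n)
    then obtain v where "run (CPrec c d) f (prod_encode (u, n)) = Some v"
      and "run d f (prod_encode (u, prod_encode (n, v))) = Some y"
      by (auto simp: bind_eq_Some_conv)
    then show ?case using Suc.IH CPrec.IH
      by (intro traceableI[of "{triple (index_of (CPrec c d)) (prod_encode (u, n)) v,
            triple (index_of d) (prod_encode (u, prod_encode (n, v))) y}"])
        (auto simp: justified_simps)
  qed
  from this[of "pfst x" "psnd x" y] CPrec.prems show ?case by simp
next
  case (CMu c)
  \<comment> \<open>The function v collects the nonzero results of the failed tests below y.\<close>
  then obtain v where "run c f (prod_encode (x, y)) = Some 0"
    and "\<And>m. m < y \<Longrightarrow> v m \<noteq> 0 \<and> run c f (prod_encode (x, m)) = Some (v m)"
    unfolding run_CMu_eq_Some by metis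
  then show ?case
    using CMu.IH
    by (intro traceableI[of "insert (triple (index_of c) (prod_encode (x, y)) 0)
          ((\<lambda>m. triple (index_of c) (prod_encode (x, m)) (v m)) ` {..<y})"])
      (auto simp: justified_simps)
qed (auto intro!: traceableI[of "{}"] simp: justified_simps simp flip: One_nat_def)

text \<open>With finite sets coded by numbers, convergence becomes an unbounded search for one
  number D.\<close>

lemma run_iff_closed_trace:
  "run (code_of i) f x = Some y \<longleftrightarrow>
     (\<exists>D. closed_trace f (set_decode D) \<and> triple i x y \<in> set_decode D)"
proof
  assume "run (code_of i) f x = Some y"
  then obtain E where "finite E" "closed_trace f E" "triple i x y \<in> E"
    using run_traceable unfolding traceable_def by (metis index_of_code_of)
  then show "\<exists>D. closed_trace f (set_decode D) \<and> triple i x y \<in> set_decode D"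
    by (intro exI[of _ "set_encode E"]) simp
next
  assume "\<exists>D. closed_trace f (set_decode D) \<and> triple i x y \<in> set_decode D"
  then show "run (code_of i) f x = Some y"
    using closed_trace_sound by (metis index_of_code_of)
qed

section \<open>Traces are decidable, and a universal code searches for them\<close>

lemma set_decode_less: "n \<in> set_decode D \<Longrightarrow> n < D"
proof (rule ccontr)
  assume n: "n \<in> set_decode D" and "\<not> n < D"
  then have "D < 2 ^ n" using less_exp[of n] by linarith
  with n show False by (simp add: set_decode_def)
qed

lemma triple_in_set_decode_less:
  assumes "triple i x y \<in> set_decode D" shows "i < D" "x < D" "y < D"
proof -
  have "i \<le> triple i x y" "prod_encode (x, y) \<le> triple i x y"
    "x \<le> prod_encode (x, y)" "y \<le> prod_encode (x, y)"
    by (rule le_prod_encode_1 le_prod_encode_2)+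
  then show "i < D" "x < D" "y < D" using set_decode_less[OF assms] by linarith+
qed

lemma decidable_closed_trace:
  "decidable_from (\<lambda>f. f) UNIV (\<lambda>f D. closed_trace f (set_decode D))"
proof -
  \<comment> \<open>Each unbounded quantifier in \<open>justified\<close> receives a computable
    bound: k is at most the index, a value v in a recorded triple is below the code D of the trace,
    and a predecessor is below its successor.\<close>
  have ex: "(\<exists>k. i = 4 * k + r \<and> Q k) \<longleftrightarrow> (\<exists>k<Suc i. i = 4 * k + r \<and> Q k)" for i r :: nat and Q
    by (auto intro!: less_Suc_eq_le[THEN iffD2])
  have ex1: "(\<exists>v. triple i x v \<in> set_decode D \<and> Q v) \<longleftrightarrow>
      (\<exists>v<D. triple i x v \<in> set_decode D \<and> Q v)" for i x D Q
    using triple_in_set_decode_less by blast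
  have ex2: "(\<exists>v. Q v \<and> triple i x v \<in> set_decode D) \<longleftrightarrow>
      (\<exists>v<D. Q v \<and> triple i x v \<in> set_decode D)" for i x D Q
    using triple_in_set_decode_less by blast
  have ex3: "(\<exists>m. n = Suc m \<and> Q m) \<longleftrightarrow> (\<exists>m<n. n = Suc m \<and> Q m)" for n Q
    by auto
  \<comment> \<open>Every number codes exactly one triple, so three quantifiers become one, which
    the code of the trace then bounds.\<close>
  have all: "(\<forall>i x y. triple i x y \<in> E \<longrightarrow> Q i x y) \<longleftrightarrow>
      (\<forall>t. t \<in> E \<longrightarrow> Q (pfst t) (pfst (psnd t)) (psnd (psnd t)))" for E Q
    by (metis fst_conv prod.collapse prod_decode_inverse prod_encode_inverse snd_conv)
  have all_less: "(\<forall>t. t \<in> set_decode D \<longrightarrow> Q t) \<longleftrightarrow> (\<forall>t<D. t \<in> set_decode D \<longrightarrow> Q t)" for D Q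
    using set_decode_less by blast
  show ?thesis
    unfolding closed_trace_def justified_def all all_less ex ex1 ex2 ex3
    by (intro computability_rules)
qed

lemma universal_code:
  obtains u where "\<And>f i x. run u f (prod_encode (i, x)) = run (code_of i) f x"
proof -
  \<comment> \<open>A single w codes the trace together with the output, so one search finds both.
    Soundness makes the output independent of the trace that is found.\<close>
  define P where "P f z w \<longleftrightarrow> closed_trace f (set_decode (pfst w)) \<and>
    triple (pfst z) (psnd z) (psnd w) \<in> set_decode (pfst w)" for f z w
  have "decidable_from (\<lambda>f. f) UNIV (\<lambda>f z. P f (pfst z) (psnd z))"
    unfolding P_def
    by (intro computability_rules decidable_compose[OF decidable_closed_trace])
  then obtain c where c: "\<And>f z. run c f z = Some (if P f (pfst z) (psnd z) then 0 else 1)"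
    unfolding decidable_from_def computable_from_def by blast
  show ?thesis
  proof (rule that[of "CComp CSnd (CMu c)"])
    fix f i x
    let ?z = "prod_encode (i, x)"
    have mu: "run (CMu c) f ?z = (if \<exists>w. P f ?z w then Some (LEAST w. P f ?z w) else None)"
      by (subst run_CMu_decision[where P = "P f ?z"]) (simp_all only: c prod_encode_inverse fst_conv snd_conv)
    have iff: "run (code_of i) f x = Some y \<longleftrightarrow> (\<exists>D. P f ?z (prod_encode (D, y)))" for y
      by (simp add: P_def run_iff_closed_trace)
    show "run (CComp CSnd (CMu c)) f ?z = run (code_of i) f x"
    proof (cases "\<exists>w. P f ?z w")
      case True
      then have "P f ?z (LEAST w. P f ?z w)" by (rule LeastI_ex)
      then have "run (code_of i) f x = Some (psnd (LEAST w. P f ?z w))"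
        unfolding iff by (metis prod.collapse prod_decode_inverse)
      then show ?thesis using True mu by simp
    next
      case False
      then have "run (code_of i) f x = None"
        using iff by (cases "run (code_of i) f x") blast+
      then show ?thesis using False mu by simp
    qed
  qed
qed

text \<open>The index itself may be computed from the oracle, which makes it possible to run a
  functional given as part of an instance. Convergence is promised on A only.\<close>

lemma computable_from_universal:
  assumes "computable_from R A F" "computable_from R A I" "computable_from R A X"
    and run: "\<And>a x. a \<in> A \<Longrightarrow> turing_functional (I a x) (F a) (X a x) = Some (G a x)"
  shows "computable_from R A G"
proof -
  obtain u where u: "\<And>f i x. run u f (prod_encode (i, x)) = run (code_of i) f x"
    by (rule universal_code) blast
  obtain r where r: "\<And>a x. a \<in> A \<Longrightarrow> run r (R a) x = Some (F a x)"
    using assms(1) by (rule computable_fromE) blast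
  obtain c where c: "\<And>a x. a \<in> A \<Longrightarrow> run c (R a) x = Some (prod_encode (I a x, X a x))"
    using computable_prod_encode[OF assms(2,3)] by (rule computable_fromE) blast
  show ?thesis
  proof (rule computable_fromI[of _ "CComp (subst_oracle r u) c"])
    fix a x assume a: "a \<in> A"
    have "run (subst_oracle r u) (R a) = run u (F a)"
      using r[OF a] by (rule run_subst_oracle)
    then show "run (CComp (subst_oracle r u) c) (R a) x = Some (G a x)"
      using run[OF a] by (simp add: c[OF a] u turing_functional_def)
  qed
qed

section \<open>What the Turing jump computes uniformly\<close>

lemma computable_halting_problem:
  "computable_from (\<lambda>a. turing_jump (R a)) A (\<lambda>a z. if run c (R a) z \<noteq> None then 1 else 0)"
proof -
  \<comment> \<open>\<open>turing_jump\<close> runs an index on itself only. To ask about c at z, c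
    is composed with a code that ignores its input and returns z.\<close>
  define const where "const z = (CComp CSucc ^^ z) CZero" for z
  have run_const: "run (const z) f x = Some z" for z f x
    unfolding const_def by (induction z) simp_all
  \<comment> \<open>This index is computable from z: 0 and 1 are the indices of \<open>CZero\<close>
    and \<open>CSucc\<close>, and 6 is the offset of \<open>CComp\<close>.\<close>
  have "index_of (const z) = rec_nat 0 (\<lambda>_ r. 4 * prod_encode (1, r) + 6) z" for z
    unfolding const_def by (induction z) simp_all
  then have "computable_from (\<lambda>a. turing_jump (R a)) A
      (\<lambda>a z. turing_jump (R a) (4 * prod_encode (index_of c, index_of (const z)) + 6))"
    by (simp only:) (intro computability_rules computable_rec_nat)
  moreover have "turing_jump f (4 * prod_encode (index_of c, index_of (const z)) + 6) =
      (if run c f z \<noteq> None then 1 else 0)" for f z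
    unfolding turing_jump_def turing_functional_def index_of.simps(7)[symmetric] code_of_index_of
    by (simp add: run_const)
  ultimately show ?thesis by simp
qed

lemma computable_oracle_from_jump: "computable_from (\<lambda>a. turing_jump (R a)) A R"
proof -
  \<comment> \<open>The test ignores its search counter, so the search converges exactly if f x = y.
    The jump thus decides the graph of f, and f x is the least y accepted.\<close>
  have "decidable_from (\<lambda>f. f) UNIV (\<lambda>f z. f (pfst (pfst z)) = psnd (pfst z))"
    by (intro computability_rules)
  then obtain c where c: "\<And>f z. run c f z = Some (if f (pfst (pfst z)) = psnd (pfst z) then 0 else 1)"
    unfolding decidable_from_def computable_from_def by blast
  have "run (CMu c) f (prod_encode (x, y)) \<noteq> None \<longleftrightarrow> f x = y" for f x y
    by (subst run_CMu_decision[where P = "\<lambda>_. f x = y"]) (simp_all add: c)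
  then have "computable_from (\<lambda>a. turing_jump (R a)) A (\<lambda>a z. if R a (pfst z) = psnd z then 1 else 0)"
    using computable_halting_problem[of R A "CMu c"]
    by (elim computable_from_cong) (metis prod.collapse prod_decode_inverse)
  then have "decidable_from (\<lambda>a. turing_jump (R a)) A
      (\<lambda>a z. (if R a (pfst z) = psnd z then 1 else 0) = (1::nat))"
    by (intro decidable_eq computable_const)
  then have "computable_from (\<lambda>a. turing_jump (R a)) A
      (\<lambda>a x. LEAST y. (if R a x = y then 1 else 0) = (1::nat))"
    by (intro computable_Least) auto
  moreover have "(LEAST y. (if n = y then 1 else 0) = (1::nat)) = n" for n :: nat
    by (rule Least_equality) (auto split: if_splits)
  ultimately show ?thesis by simp
qed

lemma computable_jump_mono:
  assumes "computable_from R A F"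
  shows "computable_from (\<lambda>a. turing_jump (R a)) A (\<lambda>a. turing_jump (F a))"
proof -
  obtain u where u: "\<And>f i x. run u f (prod_encode (i, x)) = run (code_of i) f x"
    by (rule universal_code) blast
  obtain d where d: "\<And>f x. run d f x = Some (prod_encode (x, x))"
    using computable_prod_encode[OF computable_id computable_id, of "\<lambda>f. f" UNIV]
    by (elim computable_fromE) blast
  obtain r where r: "\<And>a x. a \<in> A \<Longrightarrow> run r (R a) x = Some (F a x)"
    using assms by (rule computable_fromE) blast
  \<comment> \<open>Whether e halts on e with oracle \<open>F a\<close> is a question about the
    universal code at (e, e), and the substitution turns it into a halting question about
    \<open>R a\<close>.\<close>
  have "(if run (subst_oracle r (CComp u d)) (R a) e \<noteq> None then 1 else 0) = turing_jump (F a) e"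
    if "a \<in> A" for a e
    using run_subst_oracle[OF r, OF that, of "CComp u d"]
    by (simp add: d u turing_jump_def turing_functional_def)
  with computable_halting_problem show ?thesis by (rule computable_from_cong)
qed

section \<open>Iterated jumps of problems\<close>

primrec jump_chain :: "nat \<Rightarrow> (nat \<Rightarrow> nat) \<Rightarrow> (nat \<Rightarrow> nat) \<Rightarrow> bool" where
  "jump_chain 0 q v \<longleftrightarrow> q = v"
| "jump_chain (Suc n) q v \<longleftrightarrow>
     (\<exists>f i g. q = turing_join f (embed i) \<and> delta2_index f i g \<and> jump_chain n g v)"

lemma iter_jump_iff: "s \<in> iter_jump n P q \<longleftrightarrow> (\<exists>v. jump_chain n q v \<and> s \<in> P v)"
proof (induction n arbitrary: q)
  case 0
  show ?case by (simp add: iter_jump_def)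
next
  case (Suc n)
  have "s \<in> iter_jump (Suc n) P q \<longleftrightarrow>
      (\<exists>f i g. q = turing_join f (embed i) \<and> delta2_index f i g \<and> s \<in> iter_jump n P g)"
    by (simp add: iter_jump_def problem_jump_def)
  then show ?case by (auto simp: Suc.IH)
qed

lemma maps_to_unique: "maps_to e f g \<Longrightarrow> maps_to e f g' \<Longrightarrow> g = g'"
  unfolding maps_to_def by (metis ext option.inject)

text \<open>Joins and embeddings are injective and functionals are single-valued. Hence the
  solutions of a jumped instance are exactly those of the instance at the end of its chain.\<close>

lemma jump_chain_unique: "jump_chain n q v \<Longrightarrow> jump_chain n q v' \<Longrightarrow> v = v'"
proof (induction n arbitrary: q)
  case (Suc n)
  then obtain f i g g' where "delta2_index f i g" "jump_chain n g v"
    and "delta2_index f i g'" "jump_chain n g' v'"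
    by auto
  then show ?case using Suc.IH maps_to_unique unfolding delta2_index_def by blast
qed simp

lemma computable_turing_join_left:
  assumes "computable_from R A (\<lambda>a. turing_join (F a) (G a))"
  shows "computable_from R A F"
proof -
  have "computable_from R A (\<lambda>a x. turing_join (F a) (G a) (2 * x))"
    by (intro computable_compose[OF assms] computability_rules)
  then show ?thesis by (simp add: turing_join_def)
qed

lemma computable_turing_join_right:
  assumes "computable_from R A (\<lambda>a. turing_join (F a) (G a))"
  shows "computable_from R A G"
proof -
  have "computable_from R A (\<lambda>a x. turing_join (F a) (G a) (2 * x + 1))"
    by (intro computable_compose[OF assms] computability_rules)
  then show ?thesis by (simp add: turing_join_def)
qed

lemma computable_embed_value:
  assumes "computable_from R A (\<lambda>a. embed (N a))"
  shows "computable_from R A (\<lambda>a x. N a)"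
proof -
  have "computable_from R A (\<lambda>a x. embed (N a) 0)"
    by (intro computable_compose[OF assms] computability_rules)
  then show ?thesis by (simp add: embed_def)
qed

section \<open>The join of the jumps of choice is reducible to the first-order part\<close>

text \<open>Being in the range is convergence of a search. The offset k allows for enumerations that
  code i by i + 1.\<close>

lemma computable_range_from_jump:
  "computable_from (\<lambda>a. turing_jump (R a)) A (\<lambda>a i. if \<exists>s. R a s = k + i then 1 else 0)"
proof -
  have "decidable_from (\<lambda>f. f) UNIV (\<lambda>f z. f (psnd z) = k + pfst z)"
    by (intro computability_rules)
  then obtain c where c: "\<And>f z. run c f z = Some (if f (psnd z) = k + pfst z then 0 else 1)"
    unfolding decidable_from_def computable_from_def by blast
  have "run (CMu c) f i \<noteq> None \<longleftrightarrow> (\<exists>s. f s = k + i)" for f i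
    by (subst run_CMu_decision[where P = "\<lambda>s. f s = k + i"]) (simp_all add: c)
  then show ?thesis using computable_halting_problem[of R A "CMu c"] by simp
qed

lemma CN_instance_omits:
  assumes "v \<in> instances CN" obtains i where "\<forall>s. v s \<noteq> Suc i"
proof -
  obtain i where "Some i \<notin> range (enum_of v)"
    using assms by (auto simp: instances_def CN_def)
  then have "v s \<noteq> Suc i" for s
    unfolding image_iff enum_of_def by (metis nat.case(2) UNIV_I)
  then show ?thesis using that by blast
qed

lemma embed_in_CN_iff:
  assumes "v \<in> instances CN" shows "embed i \<in> CN v \<longleftrightarrow> (\<forall>s. v s \<noteq> Suc i)"
proof -
  have "Some i = enum_of v s \<longleftrightarrow> v s = Suc i" for s
    unfolding enum_of_def by (cases "v s") auto
  then have "Some i \<notin> range (enum_of v) \<longleftrightarrow> (\<forall>s. v s \<noteq> Suc i)"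
    by (simp add: image_iff)
  then show ?thesis using assms by (auto simp: instances_CN CN_def)
qed

text \<open>Written with the 0-1 value that \<open>computable_range_from_jump\<close> supplies, so
  that the search for it applies directly.\<close>

definition least_omitted :: "(nat \<Rightarrow> nat) \<Rightarrow> nat" where
  "least_omitted v = (LEAST i. (if \<exists>s. v s = 1 + i then 1 else 0) = (0::nat))"

lemma least_omitted_in_CN:
  assumes "v \<in> instances CN" shows "embed (least_omitted v) \<in> CN v"
proof -
  obtain i where "\<forall>s. v s \<noteq> Suc i" using assms by (rule CN_instance_omits)
  then have "(if \<exists>s. v s = 1 + i then 1 else 0) = (0::nat)" by simp
  then have "(if \<exists>s. v s = 1 + least_omitted v then 1 else 0) = (0::nat)"
    unfolding least_omitted_def by (rule LeastI)
  then show ?thesis using assms by (simp add: embed_in_CN_iff split: if_splits)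
qed

text \<open>The oracle has the shape of an instance joined with a solution of the join of the jumps
  of TJ. The number n is returned as well, because the backward functional of a strong reduction
  sees only the solution and must restore the label.\<close>

lemma computable_least_omitted:
  assumes "\<And>a. a \<in> A \<Longrightarrow> V a \<in> instances CN"
  shows "computable_from (\<lambda>a. turing_join (H a) (turing_join (embed (N a)) (turing_jump (V a)))) A
    (\<lambda>a x. prod_encode (N a, least_omitted (V a)))"
    (is "computable_from ?R A _")
proof -
  have R: "computable_from ?R A (\<lambda>a. turing_join (embed (N a)) (turing_jump (V a)))"
    by (rule computable_turing_join_right[OF computable_oracle])
  have "computable_from ?R A (\<lambda>a i. if \<exists>s. V a s = 1 + i then 1 else 0)"
    using computable_turing_join_right[OF R] computable_range_from_jump
    by (rule computable_from_trans)
  then have "decidable_from ?R A (\<lambda>a i. (if \<exists>s. V a s = 1 + i then 1 else 0) = (0::nat))"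
    by (intro decidable_eq computable_const)
  then have "decidable_from ?R A
      (\<lambda>a z. (if \<exists>s. V a s = 1 + psnd z then 1 else 0) = (0::nat))"
    by (rule decidable_compose) (intro computability_rules)
  then have "computable_from ?R A (\<lambda>a x. least_omitted (V a))"
    unfolding least_omitted_def
  proof (rule computable_Least)
    fix a x assume "a \<in> A"
    then obtain i where "\<forall>s. V a s \<noteq> Suc i" using assms CN_instance_omits by blast
    then show "\<exists>n. (if \<exists>s. V a s = 1 + n then 1 else 0) = (0::nat)" by (intro exI[of _ i]) simp
  qed
  with computable_embed_value[OF computable_turing_join_left[OF R]] show ?thesis
    by (rule computable_prod_encode)
qed

lemma join_CN_le_first_order_part:
  "problem_join (\<lambda>n. iter_jump n CN) \<le>\<^sub>s\<^sub>W
     first_order_part (problem_join (\<lambda>n. iter_jump n TJ))" (is "?B \<le>\<^sub>s\<^sub>W first_order_part ?P")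
proof -
  define A where "A = {(h :: nat \<Rightarrow> nat, n :: nat, v). v \<in> instances CN}"
  obtain e where e: "\<And>a. a \<in> A \<Longrightarrow>
      maps_to e (turing_join (fst a) (turing_join (embed (fst (snd a))) (turing_jump (snd (snd a)))))
        (\<lambda>x. prod_encode (fst (snd a), least_omitted (snd (snd a))))"
    by (rule maps_to_computable_from[OF computable_least_omitted[of A "\<lambda>a. snd (snd a)" fst
        "\<lambda>a. fst (snd a)"]]) (auto simp: A_def)
  \<comment> \<open>As a map on functions \<open>CQuery\<close> is the identity: an instance for
    choice, label included, is also an instance for TJ.\<close>
  define d where "d = index_of CQuery"
  have d: "maps_to d h h" for h
    unfolding d_def maps_to_def turing_functional_def code_of_index_of by simp
  have "computable_from (\<lambda>h. h) UNIV (\<lambda>h. turing_join h (turing_join (embed d) (embed e)))"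
    by (intro computable_turing_join computable_embed computable_oracle computable_const)
  then obtain d' where d': "maps_to d' h (turing_join h (turing_join (embed d) (embed e)))" for h
    by (rule maps_to_computable_from) blast
  have "computable_from embed UNIV (\<lambda>y x. y)"
    by (rule computable_embed_value[OF computable_oracle])
  \<comment> \<open>The backward functional splits the number y into the label n and the omitted
    number.\<close>
  then have "computable_from embed UNIV (\<lambda>y. turing_join (embed (pfst y)) (embed (psnd y)))"
    by (intro computable_turing_join computable_embed computable_pfst computable_psnd)
  then obtain e' where e': "maps_to e' (embed y) (turing_join (embed (pfst y)) (embed (psnd y)))" for y
    by (rule maps_to_computable_from) blast
  show ?thesis
    unfolding strong_weihrauch_le_def
  proof (rule exI[of _ d'], rule exI[of _ e'], rule ballI)
    fix h assume "h \<in> instances ?B"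
    then obtain n q v where h: "h = turing_join (embed n) q" and chain: "jump_chain n q v"
      and v: "v \<in> instances CN"
      unfolding instances_problem_join by (auto simp: instances_def iter_jump_iff ex_in_conv[symmetric])
    let ?p = "turing_join h (turing_join (embed d) (embed e))"
    have P: "g \<in> ?P h \<longleftrightarrow> g = turing_join (embed n) (turing_jump v)" for g
      unfolding h problem_join_def iter_jump_iff TJ_def
      using chain jump_chain_unique by auto
    have y: "turing_functional e (turing_join h (turing_join (embed n) (turing_jump v))) 0 =
        Some (prod_encode (n, least_omitted v))"
      using e[of "(h, n, v)"] v by (simp add: A_def maps_to_def)
    have fo: "fo_instance ?P h d e h"
      using d P y by (auto simp: fo_instance_def instances_def)
    \<comment> \<open>Both the value of the functional d at h and the solution to h are unique, so
      the first-order part has just one answer here.\<close>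
    have sol: "g = embed (prod_encode (n, least_omitted v))" if member: "g \<in> first_order_part ?P ?p" for g
    proof -
      obtain z p k where g: "g = embed z" and p: "fo_instance ?P h d e p" and k: "k \<in> ?P p"
        and z: "turing_functional e (turing_join h k) 0 = Some z"
        using member unfolding first_order_part_def by auto
      have "p = h" using p d by (auto simp: fo_instance_def intro: maps_to_unique)
      then show ?thesis using P k y z g by simp
    qed
    have member: "turing_join (embed n) (embed (least_omitted v)) \<in> ?B h"
      using least_omitted_in_CN[OF v] chain by (auto simp: h problem_join_def iter_jump_iff)
    have "?p \<in> instances (first_order_part ?P)"
      using fo by (auto simp: instances_first_order_part)
    then show "\<exists>p. maps_to d' h p \<and> p \<in> instances (first_order_part ?P) \<and>
        (\<forall>g\<in>first_order_part ?P p. \<exists>k. maps_to e' g k \<and> k \<in> ?B h)"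
      using d' e'[of "prod_encode (n, least_omitted v)"] member
      by (intro exI[of _ ?p]) (auto dest: sol)
  qed
qed

section \<open>The first-order part is reducible to the join of the jumps of choice\<close>

text \<open>Under the coding of i by i + 1, this enumerates all numbers but y in increasing order
  and never uses the special symbol.\<close>

definition omit_only :: "nat \<Rightarrow> nat \<Rightarrow> nat" where
  "omit_only y x = (if x < y then Suc x else Suc (Suc x))"

lemma CN_omit_only: "CN (omit_only y) = {embed y}"
proof -
  have enum: "enum_of (omit_only y) = (\<lambda>x. Some (if x < y then x else Suc x))"
    by (simp add: fun_eq_iff enum_of_def omit_only_def)
  have range: "Some i \<in> range (enum_of (omit_only y)) \<longleftrightarrow> i \<noteq> y" for i
  proof
    assume "i \<noteq> y"
    then have "Some i = enum_of (omit_only y) (if i < y then i else i - 1)"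
      unfolding enum by auto
    then show "Some i \<in> range (enum_of (omit_only y))" by (rule range_eqI)
  qed (auto simp: enum split: if_splits)
  \<comment> \<open>No value is repeated, so the constancy condition concerns no interval.\<close>
  have inj: "s = t" if "enum_of (omit_only y) s = enum_of (omit_only y) t" for s t
    using that unfolding enum by (auto split: if_splits)
  have "CN_enumeration (enum_of (omit_only y))"
    unfolding CN_enumeration_def
  proof (intro conjI allI impI)
    show "\<not> range Some \<subseteq> range (enum_of (omit_only y))"
      using range by blast
    show "enum_of (omit_only y) t \<noteq> None" for t
      by (simp add: enum)
  qed (use inj in blast)
  then show ?thesis unfolding CN_def by (simp only: range) simp
qed

text \<open>One member of the chain built for \<open>C\<^sub>N\<close>: \<open>v\<close> is the member of the original chain, \<open>f\<close> and
  \<open>u = (n, e)\<close> are needed at the end, and \<open>c\<close> is the number of steps left. The pair \<open>jk\<close> holds the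
  indices of the step functional and of the final functional; carrying it along lets the step
  functional output its own index without the recursion theorem.\<close>

definition stage :: "nat \<times> nat \<Rightarrow> nat \<Rightarrow> (nat \<Rightarrow> nat) \<Rightarrow> nat \<Rightarrow> (nat \<Rightarrow> nat) \<Rightarrow> nat \<Rightarrow> nat" where
  "stage jk u f c v = turing_join v (turing_join f (embed (prod_encode (prod_encode jk, prod_encode (u, c)))))"

text \<open>Once no step of the original chain is left, the final functional takes over.\<close>

definition stage_index :: "nat \<times> nat \<Rightarrow> nat \<Rightarrow> nat" where
  "stage_index jk c = (if c = 0 then snd jk else fst jk)"

lemma computable_from_stage:
  assumes "computable_from R A (\<lambda>a. stage (JK a) (U a) (F a) (C a) (V a))"
  shows "computable_from R A V" "computable_from R A F" "computable_from R A (\<lambda>a x. U a)"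
    "computable_from R A (\<lambda>a x. C a)" "computable_from R A (\<lambda>a x. prod_encode (JK a))"
proof -
  show "computable_from R A V"
    using assms unfolding stage_def by (rule computable_turing_join_left)
  have join: "computable_from R A (\<lambda>a. turing_join (F a)
      (embed (prod_encode (prod_encode (JK a), prod_encode (U a, C a)))))"
    using assms unfolding stage_def by (rule computable_turing_join_right)
  show "computable_from R A F"
    using join by (rule computable_turing_join_left)
  have t: "computable_from R A (\<lambda>a x. prod_encode (prod_encode (JK a), prod_encode (U a, C a)))"
    by (rule computable_embed_value[OF computable_turing_join_right[OF join]])
  show "computable_from R A (\<lambda>a x. prod_encode (JK a))"
    using computable_pfst[OF t] by simp
  show "computable_from R A (\<lambda>a x. U a)" "computable_from R A (\<lambda>a x. C a)"
    using computable_pfst[OF computable_psnd[OF t]] computable_psnd[OF computable_psnd[OF t]]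
    by simp_all
qed

lemma computable_stage_index:
  assumes "computable_from R A (\<lambda>a x. prod_encode (JK a))" "computable_from R A (\<lambda>a x. C a)"
  shows "computable_from R A (\<lambda>a x. stage_index (JK a) (C a))"
proof -
  have "computable_from R A (\<lambda>a x. if C a = 0 then psnd (prod_encode (JK a))
      else pfst (prod_encode (JK a)))"
    by (intro computability_rules assms)
  then show ?thesis by (simp add: stage_index_def cong: if_cong)
qed

lemma computable_stage:
  assumes "computable_from R A (\<lambda>a x. prod_encode (JK a))" "computable_from R A (\<lambda>a x. U a)"
    "computable_from R A F" "computable_from R A (\<lambda>a x. C a)" "computable_from R A V"
  shows "computable_from R A (\<lambda>a. stage (JK a) (U a) (F a) (C a) (V a))"
  unfolding stage_def
  by (intro computable_turing_join computable_embed computable_prod_encode assms)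

text \<open>The jump of a stage computes the stage itself and, by monotonicity, the jump of G;
  running the index I there gives W. The remaining data are copied.\<close>

lemma computable_next_stage:
  assumes "\<And>a. a \<in> A \<Longrightarrow> maps_to (I a) (turing_jump (G a)) (W a)"
  shows "computable_from
    (\<lambda>a. turing_jump (stage (JK a) (U a) (F a) (Suc (C a)) (turing_join (G a) (embed (I a))))) A
    (\<lambda>a. turing_join (stage (JK a) (U a) (F a) (C a) (W a)) (embed (stage_index (JK a) (C a))))"
    (is "computable_from (\<lambda>a. turing_jump (?S a)) A _")
proof -
  let ?R = "\<lambda>a. turing_jump (?S a)"
  have S: "computable_from ?R A ?S"
    by (rule computable_oracle_from_jump)
  have "computable_from ?S A G"
    by (rule computable_turing_join_left[OF computable_from_stage(1)[OF computable_oracle]])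
  then have "computable_from ?R A (\<lambda>a. turing_jump (G a))"
    by (rule computable_jump_mono)
  moreover have "computable_from ?R A (\<lambda>a x. I a)"
    by (rule computable_embed_value[OF computable_turing_join_right[OF computable_from_stage(1)[OF S]]])
  ultimately have "computable_from ?R A W"
    using computable_id by (rule computable_from_universal) (use assms in \<open>simp add: maps_to_def\<close>)
  \<comment> \<open>The stage in the oracle holds \<open>Suc (C a)\<close>, and the next one has one
    step less to go.\<close>
  moreover have "computable_from ?R A (\<lambda>a x. C a)"
    using computable_diff[OF computable_from_stage(4)[OF S] computable_const[of _ _ 1]] by simp
  ultimately show ?thesis
    by (intro computable_turing_join computable_embed computable_stage computable_stage_index
        computable_from_stage(2,3,5)[OF S])
qed

lemma computable_omit_only:
  assumes "computable_from R A (\<lambda>a x. Y a)"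
  shows "computable_from R A (\<lambda>a. omit_only (Y a))"
  unfolding omit_only_def by (intro computability_rules assms)

text \<open>One further jump yields the Turing jump of v, which is the TJ-solution. The functional
  with index E then returns y, and y determines the enumeration.\<close>

lemma computable_final_stage:
  assumes "\<And>a. a \<in> A \<Longrightarrow> turing_functional (E a)
    (turing_join (F a) (turing_join (embed (N a)) (turing_jump (V a)))) 0 = Some (Y a)"
  shows "computable_from (\<lambda>a. turing_jump (stage (JK a) (prod_encode (N a, E a)) (F a) 0 (V a))) A
    (\<lambda>a. omit_only (Y a))"
    (is "computable_from (\<lambda>a. turing_jump (?S a)) A _")
proof -
  let ?R = "\<lambda>a. turing_jump (?S a)"
  have S: "computable_from ?R A ?S"
    by (rule computable_oracle_from_jump)
  have V: "computable_from ?R A (\<lambda>a. turing_jump (V a))"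
    by (rule computable_jump_mono[OF computable_from_stage(1)[OF computable_oracle]])
  have N: "computable_from ?R A (\<lambda>a x. N a)" and E: "computable_from ?R A (\<lambda>a x. E a)"
    using computable_pfst[OF computable_from_stage(3)[OF S]]
      computable_psnd[OF computable_from_stage(3)[OF S]] by simp_all
  have "computable_from ?R A
      (\<lambda>a. turing_join (F a) (turing_join (embed (N a)) (turing_jump (V a))))"
    by (intro computable_turing_join computable_embed V N computable_from_stage(2)[OF S])
  then have "computable_from ?R A (\<lambda>a x. Y a)"
    using E computable_const by (rule computable_from_universal) (fact assms)
  then show ?thesis by (rule computable_omit_only)
qed

text \<open>Both functionals are found uniformly in jk, which is part of the parameter a. Only
  afterwards is jk set to the pair of their indices, and this closes the apparent circle.\<close>

lemma jump_chain_functionals: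
  obtains jk where
    "\<And>g i w u f c. maps_to i (turing_jump g) w \<Longrightarrow>
      maps_to (fst jk) (turing_jump (stage jk u f (Suc c) (turing_join g (embed i))))
        (turing_join (stage jk u f c w) (embed (stage_index jk c)))"
    "\<And>e f n v y. turing_functional e
        (turing_join f (turing_join (embed n) (turing_jump v))) 0 = Some y \<Longrightarrow>
      maps_to (snd jk) (turing_jump (stage jk (prod_encode (n, e)) f 0 v)) (omit_only y)"
proof -
  let ?A = "{(g, i, w, jk :: nat \<times> nat, u :: nat, f :: nat \<Rightarrow> nat, c :: nat).
    maps_to i (turing_jump g) w}"
  obtain j where j: "maps_to j
      (turing_jump (stage jk u f (Suc c) (turing_join g (embed i))))
      (turing_join (stage jk u f c w) (embed (stage_index jk c)))"
    if "maps_to i (turing_jump g) w" for g i w jk u f c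
    using maps_to_computable_from[OF computable_next_stage[where A = ?A
        and G = "\<lambda>(g, i, w, jk, u, f, c). g" and I = "\<lambda>(g, i, w, jk, u, f, c). i"
        and W = "\<lambda>(g, i, w, jk, u, f, c). w" and JK = "\<lambda>(g, i, w, jk, u, f, c). jk"
        and U = "\<lambda>(g, i, w, jk, u, f, c). u" and F = "\<lambda>(g, i, w, jk, u, f, c). f"
        and C = "\<lambda>(g, i, w, jk, u, f, c). c"]]
    by fastforce
  let ?B = "{(e, f, n, v, y, jk :: nat \<times> nat). turing_functional e
    (turing_join f (turing_join (embed n) (turing_jump v))) 0 = Some y}"
  obtain k where k: "maps_to k (turing_jump (stage jk (prod_encode (n, e)) f 0 v)) (omit_only y)"
    if "turing_functional e (turing_join f (turing_join (embed n) (turing_jump v))) 0 = Some y"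
    for e f n v y jk
    using maps_to_computable_from[OF computable_final_stage[where A = ?B
        and E = "\<lambda>(e, f, n, v, y, jk). e" and F = "\<lambda>(e, f, n, v, y, jk). f"
        and N = "\<lambda>(e, f, n, v, y, jk). n" and V = "\<lambda>(e, f, n, v, y, jk). v"
        and Y = "\<lambda>(e, f, n, v, y, jk). y" and JK = "\<lambda>(e, f, n, v, y, jk). jk"]]
    by fastforce
  show ?thesis by (rule that[of "(j, k)"]) (simp_all add: j k)
qed

lemma jump_chain_stage:
  assumes step: "\<And>g i w c. maps_to i (turing_jump g) w \<Longrightarrow>
      maps_to (fst jk) (turing_jump (stage jk u f (Suc c) (turing_join g (embed i))))
        (turing_join (stage jk u f c w) (embed (stage_index jk c)))"
    and final: "maps_to (snd jk) (turing_jump (stage jk u f 0 v)) w"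
  shows "jump_chain m q v \<Longrightarrow>
    jump_chain (Suc m) (turing_join (stage jk u f m q) (embed (stage_index jk m))) w"
proof (induction m arbitrary: q)
  case 0
  \<comment> \<open>At length 0 the original chain has already reached v; the final functional adds
    the one extra step.\<close>
  then show ?case using final by (auto simp: delta2_index_def stage_index_def)
next
  case (Suc m)
  then obtain g i p where q: "q = turing_join g (embed i)" and i: "maps_to i (turing_jump g) p"
    and p: "jump_chain m p v"
    by (auto simp: delta2_index_def)
  have "delta2_index (stage jk u f (Suc m) q) (stage_index jk (Suc m))
      (turing_join (stage jk u f m p) (embed (stage_index jk m)))"
    using step[OF i] by (simp add: delta2_index_def stage_index_def q)
  with Suc.IH[OF p] show ?case
    by (subst jump_chain.simps) blast
qed

text \<open>The label n and the start q of the chain occur only in the output of the functional D at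
  F, so they are obtained by running it. The pair jk is a constant.\<close>

lemma computable_first_stage:
  assumes "\<And>a. a \<in> A \<Longrightarrow> maps_to (D a) (F a) (turing_join (embed (N a)) (Q a))"
  shows "computable_from (\<lambda>a. turing_join (F a) (turing_join (embed (D a)) (embed (E a)))) A
    (\<lambda>a. turing_join (embed (Suc (N a))) (turing_join
      (stage jk (prod_encode (N a, E a)) (F a) (N a) (Q a)) (embed (stage_index jk (N a)))))"
    (is "computable_from ?R A _")
proof -
  have F: "computable_from ?R A F"
    by (rule computable_turing_join_left[OF computable_oracle])
  have DE: "computable_from ?R A (\<lambda>a. turing_join (embed (D a)) (embed (E a)))"
    by (rule computable_turing_join_right[OF computable_oracle])
  have D: "computable_from ?R A (\<lambda>a x. D a)"
    by (rule computable_embed_value[OF computable_turing_join_left[OF DE]])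
  have E: "computable_from ?R A (\<lambda>a x. E a)"
    by (rule computable_embed_value[OF computable_turing_join_right[OF DE]])
  have NQ: "computable_from ?R A (\<lambda>a. turing_join (embed (N a)) (Q a))"
    using F D computable_id
    by (rule computable_from_universal) (use assms in \<open>simp add: maps_to_def\<close>)
  note N = computable_embed_value[OF computable_turing_join_left[OF NQ]]
  note Q = computable_turing_join_right[OF NQ]
  show ?thesis
    by (intro computable_turing_join computable_embed computable_stage computable_stage_index
        computable_Suc computable_prod_encode computable_const F E N Q)
qed

lemma first_order_part_le_join_CN:
  "first_order_part (problem_join (\<lambda>n. iter_jump n TJ)) \<le>\<^sub>s\<^sub>W
     problem_join (\<lambda>n. iter_jump n CN)" (is "first_order_part ?P \<le>\<^sub>s\<^sub>W ?B")
proof -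
  obtain jk where step: "\<And>g i w u f c. maps_to i (turing_jump g) w \<Longrightarrow>
      maps_to (fst jk) (turing_jump (stage jk u f (Suc c) (turing_join g (embed i))))
        (turing_join (stage jk u f c w) (embed (stage_index jk c)))"
    and final: "\<And>e f n v y. turing_functional e
        (turing_join f (turing_join (embed n) (turing_jump v))) 0 = Some y \<Longrightarrow>
      maps_to (snd jk) (turing_jump (stage jk (prod_encode (n, e)) f 0 v)) (omit_only y)"
    by (rule jump_chain_functionals) blast
  \<comment> \<open>The forward output: the label is \<open>Suc n\<close> because the new chain is
    one step longer than the original one.\<close>
  define out where "out e f n q = turing_join (embed (Suc n)) (turing_join
      (stage jk (prod_encode (n, e)) f n q) (embed (stage_index jk n)))" for e f n q
  let ?A = "{(d, e :: nat, f, n, q). maps_to d f (turing_join (embed n) q)}"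
  obtain d' where d': "maps_to d' (turing_join f (turing_join (embed d) (embed e))) (out e f n q)"
    if "maps_to d f (turing_join (embed n) q)" for d e f n q
    using maps_to_computable_from[OF computable_first_stage[where A = ?A and jk = jk
        and D = "\<lambda>(d, e, f, n, q). d" and E = "\<lambda>(d, e, f, n, q). e"
        and F = "\<lambda>(d, e, f, n, q). f" and N = "\<lambda>(d, e, f, n, q). n"
        and Q = "\<lambda>(d, e, f, n, q). q"]]
    unfolding out_def by fastforce
  \<comment> \<open>The backward functional just drops the label.\<close>
  have "computable_from (\<lambda>a. turing_join (embed (fst a)) (embed (snd a))) UNIV (\<lambda>a. embed (snd a))"
    by (rule computable_turing_join_right[OF computable_oracle])
  then obtain e' where e': "maps_to e' (turing_join (embed n) (embed y)) (embed y)" for n y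
    by (rule maps_to_computable_from) (metis UNIV_I fst_conv snd_conv)
  show ?thesis
    unfolding strong_weihrauch_le_def
  proof (rule exI[of _ d'], rule exI[of _ e'], rule ballI)
    fix h assume "h \<in> instances (first_order_part ?P)"
    then obtain f d e p where h: "h = turing_join f (turing_join (embed d) (embed e))"
      and fo: "fo_instance ?P f d e p"
      by (auto simp: instances_first_order_part)
    then obtain g where g: "g \<in> ?P p" by (auto simp: fo_instance_def instances_def)
    then obtain n q v where p: "p = turing_join (embed n) q" and chain: "jump_chain n q v"
      and gv: "g = turing_join (embed n) (turing_jump v)"
      by (auto simp: problem_join_def iter_jump_iff TJ_def)
    obtain y where y: "turing_functional e (turing_join f g) 0 = Some y"
      using fo g by (auto simp: fo_instance_def)
    have dp: "maps_to d f (turing_join (embed n) q)"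
      using fo p by (simp add: fo_instance_def)
    have sol: "embed y \<in> first_order_part ?P h"
      unfolding first_order_part_def using h fo g y by blast
    have chain': "jump_chain (Suc n)
        (turing_join (stage jk (prod_encode (n, e)) f n q) (embed (stage_index jk n))) (omit_only y)"
      using step final[OF y[unfolded gv]] chain by (rule jump_chain_stage)
    \<comment> \<open>By uniqueness of the chain the only solutions are those of
      \<open>omit_only y\<close>, hence choice is forced to return y.\<close>
    have B: "?B (out e f n q) = {turing_join (embed (Suc n)) (embed y)}"
      unfolding problem_join_def out_def set_eq_iff iter_jump_iff mem_Collect_eq turing_join_eq_iff
        embed_eq_iff
      using chain' jump_chain_unique[OF chain'] CN_omit_only[of y] by (metis singleton_iff)
    then show "\<exists>p. maps_to d' h p \<and> p \<in> instances ?B \<and>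
        (\<forall>g\<in>?B p. \<exists>k. maps_to e' g k \<and> k \<in> first_order_part ?P h)"
      using d'[OF dp, of e] e' sol by (intro exI[of _ "out e f n q"]) (auto simp: h instances_def)
  qed
qed

theorem corollary4p3:
  "first_order_part (problem_join (\<lambda>n. iter_jump n TJ)) \<equiv>\<^sub>s\<^sub>W problem_join (\<lambda>n. iter_jump n CN)"
  unfolding strong_weihrauch_eq_def
  using first_order_part_le_join_CN join_CN_le_first_order_part by (rule conjI)

end
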